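(* Let $\mathscr{C},\mathscr{C}',\mathscr{D},\mathscr{D}'$ be triangulated categories and $\mathscr{A}$ an abelian category, let $w,w'$ be weight structures on $\mathscr{C}$ and $\mathscr{C}'$, and $t,t'$ t-structures on $\mathscr{D}$ and $\mathscr{D}'$, respectively. Let $\Phi\colon\mathscr{C}\times\mathscr{D}\to\mathscr{A}$ and $\Phi'\colon\mathscr{C}'\times\mathscr{D}'\to\mathscr{A}$ be dualities and suppose that $w$ (resp. $w'$) is w-t-strictly left orthogonal to $t$ (resp. $t'$) with respect to $\Phi$ (resp. $\Phi'$). Let $F\colon\mathscr{C}\to\mathscr{C}'$ and $G\colon\mathscr{D}'\to\mathscr{D}$ be triangulated functors which are $\Phi$-$\Phi'$-adjoint in the sense that $\Phi'(F(X),Y)\cong\Phi(X,G(Y))$ naturally for $X\in\mathscr{C}$ and $Y\in\mathscr{D}'$. Then: (1) $F(\mathscr{C}_{w>0})\subseteq\mathscr{C}'_{w'>0}$ if and only if $G(\mathscr{D}'^{t'\le0})\subseteq\mathscr{D}^{t\le0}$. (2) $F(\mathscr{C}_{w<0})\subseteq\mathscr{C}'_{w'<0}$ if and only if $G(\mathscr{D}'^{t'\ge0})\subseteq\mathscr{D}^{t\ge0}$. In particular, $F$ is weight exact if and only if $G$ is t-exact.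
   Context: All categories are linear over a fixed field. t-structures $t=(\mathscr{D}^{t\le0},\mathscr{D}^{t\ge0})$ use the cohomological convention ($\mathscr{D}^{t\le0}[1]\subseteq\mathscr{D}^{t\le0}$); $\mathscr{D}^{t<0}=\mathscr{D}^{t\le0}[1]$, $\mathscr{D}^{t>0}=\mathscr{D}^{t\ge0}[-1]$. A weight structure on $\mathscr{C}$ is a pair $w=(\mathscr{C}_{w\le0},\mathscr{C}_{w\ge0})$ of Karoubi-closed full subcategories with $\mathscr{C}_{w\le0}[1]\subseteq\mathscr{C}_{w\le0}$, $\mathscr{C}_{w\ge0}[-1]\subseteq\mathscr{C}_{w\ge0}$, $\mathrm{Hom}(\mathscr{C}_{w\ge0}[-1],\mathscr{C}_{w\le0})=0$, and every $X$ sits in a triangle $w_{>0}X\to X\to w_{\le0}X\to w_{>0}X[1]$ with $w_{>0}X\in\mathscr{C}_{w\ge0}[-1]$, $w_{\le0}X\in\mathscr{C}_{w\le0}$. Write $\mathscr{C}_{w<0}=\mathscr{C}_{w\le0}[1]$, $\mathscr{C}_{w>0}=\mathscr{C}_{w\ge0}[-1]$. A duality is a biadditive bifunctor $\Phi\colon\mathscr{C}\times\mathscr{D}\to\mathscr{A}$ into an abelian category, contravariant and cohomological in the first argument, covariant and homological in the second, with a natural isomorphism $\Phi(-,-)\cong\Phi(-[1],-[1])$. For $\mathcal{X}\subseteq\mathscr{C}$, $\mathcal{Y}\subseteq\mathscr{D}$ let $\mathcal{X}^{\perp_\Phi}=\{Y\in\mathscr{D}\mid\Phi(X,Y)=0\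 \forall X\in\mathcal{X}\}$ and ${}^{\perp_\Phi}\mathcal{Y}=\{X\in\mathscr{C}\mid\Phi(X,Y)=0\ \forall Y\in\mathcal{Y}\}$. $w$ is w-t-strictly left orthogonal to $t$ with respect to $\Phi$ if $\mathscr{C}_{w\ge0}={}^{\perp_\Phi}(\mathscr{D}^{t<0})$, $\mathscr{C}_{w\le0}={}^{\perp_\Phi}(\mathscr{D}^{t>0})$, $\mathscr{D}^{t<0}=(\mathscr{C}_{w\ge0})^{\perp_\Phi}$ and $\mathscr{D}^{t>0}=(\mathscr{C}_{w\le0})^{\perp_\Phi}$. $F$ is weight exact if $F(\mathscr{C}_{w\le0})\subseteq\mathscr{C}'_{w'\le0}$ and $F(\mathscr{C}_{w\ge0})\subseteq\mathscr{C}'_{w'\ge0}$; $G$ is t-exact if $G(\mathscr{D}'^{t'\le0})\subseteq\mathscr{D}^{t\le0}$ and $G(\mathscr{D}'^{t'\ge0})\subseteq\mathscr{D}^{t\ge0}$. *)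

theory Defs
  imports "HOL-Algebra.Module"
begin

section \<open>Linear, additive and abelian categories\<close>

text \<open>
  Hom-sets carry the module structure of \<^theory>\<open>HOL-Algebra.Module\<close>; the ring multiplication
  and unit that this record type also contains play no role. Hom-sets are required to be disjoint
  below, so that composition needs no object indices.
\<close>

record ('o, 'm, 'k) lin_cat =
  Ob :: "'o set"
  Hom :: "'o \<Rightarrow> 'o \<Rightarrow> ('k, 'm) module"
  Ident :: "'o \<Rightarrow> 'm"
  Comp :: "'m \<Rightarrow> 'm \<Rightarrow> 'm" (infixr "\<cdot>\<index>" 75)

definition in_hom :: "('o, 'm, 'k, 'x) lin_cat_scheme \<Rightarrow> 'm \<Rightarrow> 'o \<Rightarrow> 'o \<Rightarrow> bool"
    ("\<guillemotleft>_ : _ \<rightarrow>\<index> _\<guillemotright>") where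
  "in_hom C f X Y \<longleftrightarrow> X \<in> Ob C \<and> Y \<in> Ob C \<and> f \<in> carrier (Hom C X Y)"

locale linear_category =
  fixes K :: "'k ring" and C :: "('o, 'm, 'k, 'x) lin_cat_scheme"
  assumes field_K: "field K"
    and hom_module: "\<lbrakk>X \<in> Ob C; Y \<in> Ob C\<rbrakk> \<Longrightarrow> module K (Hom C X Y)"
    and hom_disjoint: "\<lbrakk>\<guillemotleft>f : X \<rightarrow>\<^bsub>C\<^esub> Y\<guillemotright>; \<guillemotleft>f : X' \<rightarrow>\<^bsub>C\<^esub> Y'\<guillemotright>\<rbrakk> \<Longrightarrow> X = X' \<and> Y = Y'"
    and ident_in_hom: "X \<in> Ob C \<Longrightarrow> \<guillemotleft>Ident C X : X \<rightarrow>\<^bsub>C\<^esub> X\<guillemotright>"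
    and comp_in_hom: "\<lbrakk>\<guillemotleft>f : X \<rightarrow>\<^bsub>C\<^esub> Y\<guillemotright>; \<guillemotleft>g : Y \<rightarrow>\<^bsub>C\<^esub> Z\<guillemotright>\<rbrakk> \<Longrightarrow> \<guillemotleft>g \<cdot>\<^bsub>C\<^esub> f : X \<rightarrow>\<^bsub>C\<^esub> Z\<guillemotright>"
    and comp_ident: "\<guillemotleft>f : X \<rightarrow>\<^bsub>C\<^esub> Y\<guillemotright> \<Longrightarrow> f \<cdot>\<^bsub>C\<^esub> Ident C X = f"
    and ident_comp: "\<guillemotleft>f : X \<rightarrow>\<^bsub>C\<^esub> Y\<guillemotright> \<Longrightarrow> Ident C Y \<cdot>\<^bsub>C\<^esub> f = f"
    and comp_assoc: "\<lbrakk>\<guillemotleft>f : X \<rightarrow>\<^bsub>C\<^esub> Y\<guillemotright>; \<guillemotleft>g : Y \<rightarrow>\<^bsub>C\<^esub> Z\<guillemotright>; \<guillemotleft>h : Z \<rightarrow>\<^bsub>C\<^esub> V\<guillemotright>\<rbrakk>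
          \<Longrightarrow> (h \<cdot>\<^bsub>C\<^esub> g) \<cdot>\<^bsub>C\<^esub> f = h \<cdot>\<^bsub>C\<^esub> (g \<cdot>\<^bsub>C\<^esub> f)"
    and comp_add_right: "\<lbrakk>\<guillemotleft>f : X \<rightarrow>\<^bsub>C\<^esub> Y\<guillemotright>; \<guillemotleft>f' : X \<rightarrow>\<^bsub>C\<^esub> Y\<guillemotright>; \<guillemotleft>g : Y \<rightarrow>\<^bsub>C\<^esub> Z\<guillemotright>\<rbrakk>
          \<Longrightarrow> g \<cdot>\<^bsub>C\<^esub> (f \<oplus>\<^bsub>Hom C X Y\<^esub> f') = (g \<cdot>\<^bsub>C\<^esub> f) \<oplus>\<^bsub>Hom C X Z\<^esub> (g \<cdot>\<^bsub>C\<^esub> f')"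
    and comp_add_left: "\<lbrakk>\<guillemotleft>f : X \<rightarrow>\<^bsub>C\<^esub> Y\<guillemotright>; \<guillemotleft>g : Y \<rightarrow>\<^bsub>C\<^esub> Z\<guillemotright>; \<guillemotleft>g' : Y \<rightarrow>\<^bsub>C\<^esub> Z\<guillemotright>\<rbrakk>
          \<Longrightarrow> (g \<oplus>\<^bsub>Hom C Y Z\<^esub> g') \<cdot>\<^bsub>C\<^esub> f = (g \<cdot>\<^bsub>C\<^esub> f) \<oplus>\<^bsub>Hom C X Z\<^esub> (g' \<cdot>\<^bsub>C\<^esub> f)"
    and comp_smult_right: "\<lbrakk>a \<in> carrier K; \<guillemotleft>f : X \<rightarrow>\<^bsub>C\<^esub> Y\<guillemotright>; \<guillemotleft>g : Y \<rightarrow>\<^bsub>C\<^esub> Z\<guillemotright>\<rbrakk>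
          \<Longrightarrow> g \<cdot>\<^bsub>C\<^esub> (a \<odot>\<^bsub>Hom C X Y\<^esub> f) = a \<odot>\<^bsub>Hom C X Z\<^esub> (g \<cdot>\<^bsub>C\<^esub> f)"
    and comp_smult_left: "\<lbrakk>a \<in> carrier K; \<guillemotleft>f : X \<rightarrow>\<^bsub>C\<^esub> Y\<guillemotright>; \<guillemotleft>g : Y \<rightarrow>\<^bsub>C\<^esub> Z\<guillemotright>\<rbrakk>
          \<Longrightarrow> (a \<odot>\<^bsub>Hom C Y Z\<^esub> g) \<cdot>\<^bsub>C\<^esub> f = a \<odot>\<^bsub>Hom C X Z\<^esub> (g \<cdot>\<^bsub>C\<^esub> f)"

definition iso_arr :: "('o, 'm, 'k, 'x) lin_cat_scheme \<Rightarrow> 'm \<Rightarrow> 'o \<Rightarrow> 'o \<Rightarrow> bool" where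
  "iso_arr C f X Y \<longleftrightarrow> \<guillemotleft>f : X \<rightarrow>\<^bsub>C\<^esub> Y\<guillemotright> \<and>
     (\<exists>g. \<guillemotleft>g : Y \<rightarrow>\<^bsub>C\<^esub> X\<guillemotright> \<and> g \<cdot>\<^bsub>C\<^esub> f = Ident C X \<and> f \<cdot>\<^bsub>C\<^esub> g = Ident C Y)"

definition isomorphic :: "('o, 'm, 'k, 'x) lin_cat_scheme \<Rightarrow> 'o \<Rightarrow> 'o \<Rightarrow> bool" where
  "isomorphic C X Y \<longleftrightarrow> (\<exists>f. iso_arr C f X Y)"

definition zero_object :: "('o, 'm, 'k, 'x) lin_cat_scheme \<Rightarrow> 'o \<Rightarrow> bool" where
  "zero_object C Z \<longleftrightarrow> Z \<in> Ob C \<and>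
     (\<forall>X\<in>Ob C. (\<exists>!f. \<guillemotleft>f : X \<rightarrow>\<^bsub>C\<^esub> Z\<guillemotright>) \<and> (\<exists>!f. \<guillemotleft>f : Z \<rightarrow>\<^bsub>C\<^esub> X\<guillemotright>))"

definition biproduct ::
    "('o, 'm, 'k, 'x) lin_cat_scheme \<Rightarrow> 'o \<Rightarrow> 'o \<Rightarrow> 'o \<Rightarrow> 'm \<Rightarrow> 'm \<Rightarrow> 'm \<Rightarrow> 'm \<Rightarrow> bool" where
  "biproduct C X Y P i j p q \<longleftrightarrow>
     \<guillemotleft>i : X \<rightarrow>\<^bsub>C\<^esub> P\<guillemotright> \<and> \<guillemotleft>j : Y \<rightarrow>\<^bsub>C\<^esub> P\<guillemotright> \<and> \<guillemotleft>p : P \<rightarrow>\<^bsub>C\<^esub> X\<guillemotright> \<and> \<guillemotleft>q : P \<rightarrow>\<^bsub>C\<^esub> Y\<guillemotright> \<and>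
     p \<cdot>\<^bsub>C\<^esub> i = Ident C X \<and> q \<cdot>\<^bsub>C\<^esub> j = Ident C Y \<and>
     q \<cdot>\<^bsub>C\<^esub> i = \<zero>\<^bsub>Hom C X Y\<^esub> \<and> p \<cdot>\<^bsub>C\<^esub> j = \<zero>\<^bsub>Hom C Y X\<^esub> \<and>
     (i \<cdot>\<^bsub>C\<^esub> p) \<oplus>\<^bsub>Hom C P P\<^esub> (j \<cdot>\<^bsub>C\<^esub> q) = Ident C P"

locale additive_category = linear_category +
  assumes ex_zero_object: "\<exists>Z. zero_object C Z"
    and ex_biproduct: "\<lbrakk>X \<in> Ob C; Y \<in> Ob C\<rbrakk> \<Longrightarrow> \<exists>P i j p q. biproduct C X Y P i j p q"

definition mono_arr :: "('o, 'm, 'k, 'x) lin_cat_scheme \<Rightarrow> 'm \<Rightarrow> 'o \<Rightarrow> 'o \<Rightarrow> bool" where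
  "mono_arr C f X Y \<longleftrightarrow> \<guillemotleft>f : X \<rightarrow>\<^bsub>C\<^esub> Y\<guillemotright> \<and>
     (\<forall>V a b. \<guillemotleft>a : V \<rightarrow>\<^bsub>C\<^esub> X\<guillemotright> \<and> \<guillemotleft>b : V \<rightarrow>\<^bsub>C\<^esub> X\<guillemotright> \<and> f \<cdot>\<^bsub>C\<^esub> a = f \<cdot>\<^bsub>C\<^esub> b \<longrightarrow> a = b)"

definition epi_arr :: "('o, 'm, 'k, 'x) lin_cat_scheme \<Rightarrow> 'm \<Rightarrow> 'o \<Rightarrow> 'o \<Rightarrow> bool" where
  "epi_arr C f X Y \<longleftrightarrow> \<guillemotleft>f : X \<rightarrow>\<^bsub>C\<^esub> Y\<guillemotright> \<and>
     (\<forall>V a b. \<guillemotleft>a : Y \<rightarrow>\<^bsub>C\<^esub> V\<guillemotright> \<and> \<guillemotleft>b : Y \<rightarrow>\<^bsub>C\<^esub> V\<guillemotright> \<and> a \<cdot>\<^bsub>C\<^esub> f = b \<cdot>\<^bsub>C\<^esub> f \<longrightarrow> a = b)"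

definition is_kernel :: "('o, 'm, 'k, 'x) lin_cat_scheme \<Rightarrow> 'm \<Rightarrow> 'm \<Rightarrow> bool" where
  "is_kernel C k f \<longleftrightarrow> (\<exists>N X Y. \<guillemotleft>k : N \<rightarrow>\<^bsub>C\<^esub> X\<guillemotright> \<and> \<guillemotleft>f : X \<rightarrow>\<^bsub>C\<^esub> Y\<guillemotright> \<and> f \<cdot>\<^bsub>C\<^esub> k = \<zero>\<^bsub>Hom C N Y\<^esub> \<and>
     (\<forall>V a. \<guillemotleft>a : V \<rightarrow>\<^bsub>C\<^esub> X\<guillemotright> \<and> f \<cdot>\<^bsub>C\<^esub> a = \<zero>\<^bsub>Hom C V Y\<^esub> \<longrightarrow> (\<exists>!b. \<guillemotleft>b : V \<rightarrow>\<^bsub>C\<^esub> N\<guillemotright> \<and> k \<cdot>\<^bsub>C\<^esub> b = a)))"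

definition is_cokernel :: "('o, 'm, 'k, 'x) lin_cat_scheme \<Rightarrow> 'm \<Rightarrow> 'm \<Rightarrow> bool" where
  "is_cokernel C c f \<longleftrightarrow> (\<exists>X Y Q. \<guillemotleft>f : X \<rightarrow>\<^bsub>C\<^esub> Y\<guillemotright> \<and> \<guillemotleft>c : Y \<rightarrow>\<^bsub>C\<^esub> Q\<guillemotright> \<and> c \<cdot>\<^bsub>C\<^esub> f = \<zero>\<^bsub>Hom C X Q\<^esub> \<and>
     (\<forall>V a. \<guillemotleft>a : Y \<rightarrow>\<^bsub>C\<^esub> V\<guillemotright> \<and> a \<cdot>\<^bsub>C\<^esub> f = \<zero>\<^bsub>Hom C X V\<^esub> \<longrightarrow> (\<exists>!b. \<guillemotleft>b : Q \<rightarrow>\<^bsub>C\<^esub> V\<guillemotright> \<and> b \<cdot>\<^bsub>C\<^esub> c = a)))"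

locale abelian_category = additive_category +
  assumes ex_kernel: "\<guillemotleft>f : X \<rightarrow>\<^bsub>C\<^esub> Y\<guillemotright> \<Longrightarrow> \<exists>k. is_kernel C k f"
    and ex_cokernel: "\<guillemotleft>f : X \<rightarrow>\<^bsub>C\<^esub> Y\<guillemotright> \<Longrightarrow> \<exists>c. is_cokernel C c f"
    and mono_is_kernel: "mono_arr C f X Y \<Longrightarrow> \<exists>g. is_kernel C f g"
    and epi_is_cokernel: "epi_arr C f X Y \<Longrightarrow> \<exists>g. is_cokernel C f g"

definition is_image :: "('o, 'm, 'k, 'x) lin_cat_scheme \<Rightarrow> 'm \<Rightarrow> 'm \<Rightarrow> bool" where
  "is_image C i f \<longleftrightarrow> (\<exists>c. is_cokernel C c f \<and> is_kernel C i c)"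

definition exact_seq :: "('o, 'm, 'k, 'x) lin_cat_scheme \<Rightarrow> 'm \<Rightarrow> 'm \<Rightarrow> bool" where
  "exact_seq C f g \<longleftrightarrow> (\<exists>i. is_image C i f \<and> is_kernel C i g)"


section \<open>Functors and triangulated categories\<close>

record ('o, 'm, 'p, 'n) funct =
  fob :: "'o \<Rightarrow> 'p"
  far :: "'m \<Rightarrow> 'n"

definition additive_functor ::
    "('o, 'm, 'k, 'x) lin_cat_scheme \<Rightarrow> ('p, 'n, 'k, 'y) lin_cat_scheme \<Rightarrow> ('o, 'm, 'p, 'n) funct \<Rightarrow> bool"
  where
  "additive_functor C D F \<longleftrightarrow>
     (\<forall>X\<in>Ob C. fob F X \<in> Ob D) \<and>
     (\<forall>X Y f. \<guillemotleft>f : X \<rightarrow>\<^bsub>C\<^esub> Y\<guillemotright> \<longrightarrow> \<guillemotleft>far F f : fob F X \<rightarrow>\<^bsub>D\<^esub> fob F Y\<guillemotright>) \<and>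
     (\<forall>X\<in>Ob C. far F (Ident C X) = Ident D (fob F X)) \<and>
     (\<forall>X Y Z f g. \<guillemotleft>f : X \<rightarrow>\<^bsub>C\<^esub> Y\<guillemotright> \<and> \<guillemotleft>g : Y \<rightarrow>\<^bsub>C\<^esub> Z\<guillemotright> \<longrightarrow> far F (g \<cdot>\<^bsub>C\<^esub> f) = far F g \<cdot>\<^bsub>D\<^esub> far F f) \<and>
     (\<forall>X Y f g. \<guillemotleft>f : X \<rightarrow>\<^bsub>C\<^esub> Y\<guillemotright> \<and> \<guillemotleft>g : X \<rightarrow>\<^bsub>C\<^esub> Y\<guillemotright> \<longrightarrow>
        far F (f \<oplus>\<^bsub>Hom C X Y\<^esub> g) = far F f \<oplus>\<^bsub>Hom D (fob F X) (fob F Y)\<^esub> far F g)"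

definition linear_functor ::
    "'k ring \<Rightarrow> ('o, 'm, 'k, 'x) lin_cat_scheme \<Rightarrow> ('p, 'n, 'k, 'y) lin_cat_scheme \<Rightarrow>
     ('o, 'm, 'p, 'n) funct \<Rightarrow> bool"
  where
  "linear_functor K C D F \<longleftrightarrow> additive_functor C D F \<and>
     (\<forall>a X Y f. a \<in> carrier K \<and> \<guillemotleft>f : X \<rightarrow>\<^bsub>C\<^esub> Y\<guillemotright> \<longrightarrow>
        far F (a \<odot>\<^bsub>Hom C X Y\<^esub> f) = a \<odot>\<^bsub>Hom D (fob F X) (fob F Y)\<^esub> far F f)"

definition equivalence :: "('o, 'm, 'k, 'x) lin_cat_scheme \<Rightarrow> ('p, 'n, 'k, 'y) lin_cat_scheme \<Rightarrow>
     ('o, 'm, 'p, 'n) funct \<Rightarrow> bool" where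
  "equivalence C D F \<longleftrightarrow> additive_functor C D F \<and>
     (\<forall>X\<in>Ob C. \<forall>Y\<in>Ob C.
        bij_betw (far F) (carrier (Hom C X Y)) (carrier (Hom D (fob F X) (fob F Y)))) \<and>
     (\<forall>Y\<in>Ob D. \<exists>X\<in>Ob C. isomorphic D (fob F X) Y)"

record ('o, 'm, 'k) tri_cat = "('o, 'm, 'k) lin_cat" +
  shift :: "('o, 'm, 'o, 'm) funct"
  dist :: "('m \<times> 'm \<times> 'm) set"

abbreviation sh_ob :: "('o, 'm, 'k, 'x) tri_cat_scheme \<Rightarrow> 'o \<Rightarrow> 'o" where
  "sh_ob C \<equiv> fob (shift C)"

abbreviation sh_ar :: "('o, 'm, 'k, 'x) tri_cat_scheme \<Rightarrow> 'm \<Rightarrow> 'm" where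
  "sh_ar C \<equiv> far (shift C)"

definition triangle ::
    "('o, 'm, 'k, 'x) tri_cat_scheme \<Rightarrow> 'o \<Rightarrow> 'o \<Rightarrow> 'o \<Rightarrow> 'm \<Rightarrow> 'm \<Rightarrow> 'm \<Rightarrow> bool" where
  "triangle C X Y Z f g h \<longleftrightarrow> \<guillemotleft>f : X \<rightarrow>\<^bsub>C\<^esub> Y\<guillemotright> \<and> \<guillemotleft>g : Y \<rightarrow>\<^bsub>C\<^esub> Z\<guillemotright> \<and> \<guillemotleft>h : Z \<rightarrow>\<^bsub>C\<^esub> sh_ob C X\<guillemotright>"

definition dist_triangle ::
    "('o, 'm, 'k, 'x) tri_cat_scheme \<Rightarrow> 'o \<Rightarrow> 'o \<Rightarrow> 'o \<Rightarrow> 'm \<Rightarrow> 'm \<Rightarrow> 'm \<Rightarrow> bool" where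
  "dist_triangle C X Y Z f g h \<longleftrightarrow> triangle C X Y Z f g h \<and> (f, g, h) \<in> dist C"

text \<open>
  The shift is only required to be an autoequivalence; a strict automorphism is a special case.
\<close>

locale triangulated_category = additive_category K C
  for K :: "'k ring" and C :: "('o, 'm, 'k, 'x) tri_cat_scheme" +
  assumes shift_linear: "linear_functor K C C (shift C)"
    and shift_equivalence: "equivalence C C (shift C)"
    and dist_is_triangle: "(f, g, h) \<in> dist C \<Longrightarrow> \<exists>X Y Z. triangle C X Y Z f g h"
    and TR1_iso: "\<lbrakk>dist_triangle C X Y Z f g h; triangle C X' Y' Z' f' g' h';
          iso_arr C a X X'; iso_arr C b Y Y'; iso_arr C c Z Z';
          b \<cdot>\<^bsub>C\<^esub> f = f' \<cdot>\<^bsub>C\<^esub> a; c \<cdot>\<^bsub>C\<^esub> g = g' \<cdot>\<^bsub>C\<^esub> b; sh_ar C a \<cdot>\<^bsub>C\<^esub> h = h' \<cdot>\<^bsub>C\<^esub> c\<rbrakk>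
          \<Longrightarrow> dist_triangle C X' Y' Z' f' g' h'"
    and TR1_id: "\<lbrakk>X \<in> Ob C; zero_object C Z\<rbrakk> \<Longrightarrow>
          dist_triangle C X X Z (Ident C X) \<zero>\<^bsub>Hom C X Z\<^esub> \<zero>\<^bsub>Hom C Z (sh_ob C X)\<^esub>"
    and TR1_cone: "\<guillemotleft>f : X \<rightarrow>\<^bsub>C\<^esub> Y\<guillemotright> \<Longrightarrow> \<exists>Z g h. dist_triangle C X Y Z f g h"
    and TR2: "triangle C X Y Z f g h \<Longrightarrow>
          dist_triangle C X Y Z f g h \<longleftrightarrow>
          dist_triangle C Y Z (sh_ob C X) g h (\<ominus>\<^bsub>Hom C (sh_ob C X) (sh_ob C Y)\<^esub> sh_ar C f)"
    and TR3: "\<lbrakk>dist_triangle C X Y Z f g h; dist_triangle C X' Y' Z' f' g' h';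
          \<guillemotleft>a : X \<rightarrow>\<^bsub>C\<^esub> X'\<guillemotright>; \<guillemotleft>b : Y \<rightarrow>\<^bsub>C\<^esub> Y'\<guillemotright>; b \<cdot>\<^bsub>C\<^esub> f = f' \<cdot>\<^bsub>C\<^esub> a\<rbrakk>
          \<Longrightarrow> \<exists>c. \<guillemotleft>c : Z \<rightarrow>\<^bsub>C\<^esub> Z'\<guillemotright> \<and> c \<cdot>\<^bsub>C\<^esub> g = g' \<cdot>\<^bsub>C\<^esub> b \<and> sh_ar C a \<cdot>\<^bsub>C\<^esub> h = h' \<cdot>\<^bsub>C\<^esub> c"
    and TR4: "\<lbrakk>dist_triangle C X Y Z' f f' f''; dist_triangle C Y Z X' g g' g'';
          dist_triangle C X Z Y' (g \<cdot>\<^bsub>C\<^esub> f) h' h''\<rbrakk>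
          \<Longrightarrow> \<exists>u v. dist_triangle C Z' Y' X' u v (sh_ar C f' \<cdot>\<^bsub>C\<^esub> g'') \<and>
                u \<cdot>\<^bsub>C\<^esub> f' = h' \<cdot>\<^bsub>C\<^esub> g \<and> v \<cdot>\<^bsub>C\<^esub> h' = g' \<and>
                h'' \<cdot>\<^bsub>C\<^esub> u = f'' \<and> g'' \<cdot>\<^bsub>C\<^esub> v = sh_ar C f \<cdot>\<^bsub>C\<^esub> h''"

definition triangulated_functor ::
    "('o, 'm, 'k, 'x) tri_cat_scheme \<Rightarrow> ('p, 'n, 'k, 'y) tri_cat_scheme \<Rightarrow>
     ('o, 'm, 'p, 'n) funct \<Rightarrow> bool"
  where
  "triangulated_functor C D F \<longleftrightarrow> additive_functor C D F \<and>
     (\<exists>\<xi>. (\<forall>X\<in>Ob C. iso_arr D (\<xi> X) (fob F (sh_ob C X)) (sh_ob D (fob F X))) \<and>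
          (\<forall>X Y f. \<guillemotleft>f : X \<rightarrow>\<^bsub>C\<^esub> Y\<guillemotright> \<longrightarrow>
             \<xi> Y \<cdot>\<^bsub>D\<^esub> far F (sh_ar C f) = sh_ar D (far F f) \<cdot>\<^bsub>D\<^esub> \<xi> X) \<and>
          (\<forall>X Y Z f g h. dist_triangle C X Y Z f g h \<longrightarrow>
             dist_triangle D (fob F X) (fob F Y) (fob F Z) (far F f) (far F g) (\<xi> X \<cdot>\<^bsub>D\<^esub> far F h)))"


section \<open>Weight structures and t-structures\<close>

text \<open>
  Full subcategories are given by their sets of objects. Only subcategories closed under
  isomorphism are shifted. For these, \<open>sub_up C S\<close> is \<open>S[1]\<close>, closed under isomorphism, and
  \<open>sub_down C S\<close> is \<open>S[-1]\<close>, closed under isomorphism: no choice of a quasi-inverse of the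
  shift is needed.
\<close>

definition sub_up :: "('o, 'm, 'k, 'x) tri_cat_scheme \<Rightarrow> 'o set \<Rightarrow> 'o set" where
  "sub_up C S = {X \<in> Ob C. \<exists>Y\<in>S. isomorphic C (sh_ob C Y) X}"

definition sub_down :: "('o, 'm, 'k, 'x) tri_cat_scheme \<Rightarrow> 'o set \<Rightarrow> 'o set" where
  "sub_down C S = {X \<in> Ob C. sh_ob C X \<in> S}"

definition hom_vanish :: "('o, 'm, 'k, 'x) lin_cat_scheme \<Rightarrow> 'o set \<Rightarrow> 'o set \<Rightarrow> bool" where
  "hom_vanish C S T \<longleftrightarrow> (\<forall>X\<in>S. \<forall>Y\<in>T. carrier (Hom C X Y) = {\<zero>\<^bsub>Hom C X Y\<^esub>})"

definition iso_closed :: "('o, 'm, 'k, 'x) lin_cat_scheme \<Rightarrow> 'o set \<Rightarrow> bool" where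
  "iso_closed C S \<longleftrightarrow> S \<subseteq> Ob C \<and> (\<forall>X\<in>S. \<forall>Y. isomorphic C X Y \<longrightarrow> Y \<in> S)"

definition karoubi_closed :: "('o, 'm, 'k, 'x) lin_cat_scheme \<Rightarrow> 'o set \<Rightarrow> bool" where
  "karoubi_closed C S \<longleftrightarrow> S \<subseteq> Ob C \<and>
     (\<forall>X\<in>S. \<forall>Y i p. \<guillemotleft>i : Y \<rightarrow>\<^bsub>C\<^esub> X\<guillemotright> \<and> \<guillemotleft>p : X \<rightarrow>\<^bsub>C\<^esub> Y\<guillemotright> \<and> p \<cdot>\<^bsub>C\<^esub> i = Ident C Y \<longrightarrow> Y \<in> S)"

record 'o weight =
  w_le0 :: "'o set"
  w_ge0 :: "'o set"

abbreviation w_lt0 :: "('o, 'm, 'k, 'x) tri_cat_scheme \<Rightarrow> 'o weight \<Rightarrow> 'o set" where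
  "w_lt0 C w \<equiv> sub_up C (w_le0 w)"

abbreviation w_gt0 :: "('o, 'm, 'k, 'x) tri_cat_scheme \<Rightarrow> 'o weight \<Rightarrow> 'o set" where
  "w_gt0 C w \<equiv> sub_down C (w_ge0 w)"

definition weight_structure :: "('o, 'm, 'k, 'x) tri_cat_scheme \<Rightarrow> 'o weight \<Rightarrow> bool" where
  "weight_structure C w \<longleftrightarrow>
     karoubi_closed C (w_le0 w) \<and> karoubi_closed C (w_ge0 w) \<and>
     sub_up C (w_le0 w) \<subseteq> w_le0 w \<and> sub_down C (w_ge0 w) \<subseteq> w_ge0 w \<and>
     hom_vanish C (w_gt0 C w) (w_le0 w) \<and>
     (\<forall>X\<in>Ob C. \<exists>P\<in>w_gt0 C w. \<exists>Q\<in>w_le0 w. \<exists>f g h. dist_triangle C P X Q f g h)"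

record 'o tstr =
  t_le0 :: "'o set"
  t_ge0 :: "'o set"

abbreviation t_lt0 :: "('o, 'm, 'k, 'x) tri_cat_scheme \<Rightarrow> 'o tstr \<Rightarrow> 'o set" where
  "t_lt0 D t \<equiv> sub_up D (t_le0 t)"

abbreviation t_gt0 :: "('o, 'm, 'k, 'x) tri_cat_scheme \<Rightarrow> 'o tstr \<Rightarrow> 'o set" where
  "t_gt0 D t \<equiv> sub_down D (t_ge0 t)"

definition t_structure :: "('o, 'm, 'k, 'x) tri_cat_scheme \<Rightarrow> 'o tstr \<Rightarrow> bool" where
  "t_structure D t \<longleftrightarrow>
     iso_closed D (t_le0 t) \<and> iso_closed D (t_ge0 t) \<and>
     sub_up D (t_le0 t) \<subseteq> t_le0 t \<and> sub_down D (t_ge0 t) \<subseteq> t_ge0 t \<and>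
     hom_vanish D (t_le0 t) (t_gt0 D t) \<and>
     (\<forall>X\<in>Ob D. \<exists>P\<in>t_le0 t. \<exists>Q\<in>t_gt0 D t. \<exists>f g h. dist_triangle D P X Q f g h)"

definition weight_exact :: "'o weight \<Rightarrow> 'p weight \<Rightarrow> ('o, 'm, 'p, 'n) funct \<Rightarrow> bool" where
  "weight_exact w w' F \<longleftrightarrow> fob F ` w_le0 w \<subseteq> w_le0 w' \<and> fob F ` w_ge0 w \<subseteq> w_ge0 w'"

definition t_exact :: "'o tstr \<Rightarrow> 'p tstr \<Rightarrow> ('o, 'm, 'p, 'n) funct \<Rightarrow> bool" where
  "t_exact t t' G \<longleftrightarrow> fob G ` t_le0 t \<subseteq> t_le0 t' \<and> fob G ` t_ge0 t \<subseteq> t_ge0 t'"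


section \<open>Dualities and orthogonality\<close>

text \<open>
  \<open>bar \<Phi> f g\<close> is \<open>\<Phi>(f, g)\<close>. For \<open>f : X \<rightarrow> X'\<close> and \<open>g : Y \<rightarrow> Y'\<close> it is a morphism
  \<open>\<Phi>(X', Y) \<rightarrow> \<Phi>(X, Y')\<close>.
\<close>

record ('o, 'm, 'p, 'n, 'a, 'b) bifunct =
  bob :: "'o \<Rightarrow> 'p \<Rightarrow> 'a"
  bar :: "'m \<Rightarrow> 'n \<Rightarrow> 'b"

definition biadditive_bifunctor ::
    "('o, 'm, 'k, 'x) lin_cat_scheme \<Rightarrow> ('p, 'n, 'k, 'y) lin_cat_scheme \<Rightarrow>
     ('a, 'b, 'k, 'z) lin_cat_scheme \<Rightarrow> ('o, 'm, 'p, 'n, 'a, 'b) bifunct \<Rightarrow> bool"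
  where
  "biadditive_bifunctor C D A \<Phi> \<longleftrightarrow>
     (\<forall>X\<in>Ob C. \<forall>Y\<in>Ob D. bob \<Phi> X Y \<in> Ob A) \<and>
     (\<forall>X X' Y Y' f g. \<guillemotleft>f : X \<rightarrow>\<^bsub>C\<^esub> X'\<guillemotright> \<and> \<guillemotleft>g : Y \<rightarrow>\<^bsub>D\<^esub> Y'\<guillemotright> \<longrightarrow>
        \<guillemotleft>bar \<Phi> f g : bob \<Phi> X' Y \<rightarrow>\<^bsub>A\<^esub> bob \<Phi> X Y'\<guillemotright>) \<and>
     (\<forall>X\<in>Ob C. \<forall>Y\<in>Ob D. bar \<Phi> (Ident C X) (Ident D Y) = Ident A (bob \<Phi> X Y)) \<and>
     (\<forall>X X' X'' Y Y' Y'' f f' g g'.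
        \<guillemotleft>f : X \<rightarrow>\<^bsub>C\<^esub> X'\<guillemotright> \<and> \<guillemotleft>f' : X' \<rightarrow>\<^bsub>C\<^esub> X''\<guillemotright> \<and> \<guillemotleft>g : Y \<rightarrow>\<^bsub>D\<^esub> Y'\<guillemotright> \<and> \<guillemotleft>g' : Y' \<rightarrow>\<^bsub>D\<^esub> Y''\<guillemotright> \<longrightarrow>
        bar \<Phi> (f' \<cdot>\<^bsub>C\<^esub> f) (g' \<cdot>\<^bsub>D\<^esub> g) = bar \<Phi> f g' \<cdot>\<^bsub>A\<^esub> bar \<Phi> f' g) \<and>
     (\<forall>X X' Y Y' f f' g. \<guillemotleft>f : X \<rightarrow>\<^bsub>C\<^esub> X'\<guillemotright> \<and> \<guillemotleft>f' : X \<rightarrow>\<^bsub>C\<^esub> X'\<guillemotright> \<and> \<guillemotleft>g : Y \<rightarrow>\<^bsub>D\<^esub> Y'\<guillemotright> \<longrightarrow>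
        bar \<Phi> (f \<oplus>\<^bsub>Hom C X X'\<^esub> f') g
          = bar \<Phi> f g \<oplus>\<^bsub>Hom A (bob \<Phi> X' Y) (bob \<Phi> X Y')\<^esub> bar \<Phi> f' g) \<and>
     (\<forall>X X' Y Y' f g g'. \<guillemotleft>f : X \<rightarrow>\<^bsub>C\<^esub> X'\<guillemotright> \<and> \<guillemotleft>g : Y \<rightarrow>\<^bsub>D\<^esub> Y'\<guillemotright> \<and> \<guillemotleft>g' : Y \<rightarrow>\<^bsub>D\<^esub> Y'\<guillemotright> \<longrightarrow>
        bar \<Phi> f (g \<oplus>\<^bsub>Hom D Y Y'\<^esub> g')
          = bar \<Phi> f g \<oplus>\<^bsub>Hom A (bob \<Phi> X' Y) (bob \<Phi> X Y')\<^esub> bar \<Phi> f g')"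

definition duality ::
    "('o, 'm, 'k, 'x) tri_cat_scheme \<Rightarrow> ('p, 'n, 'k, 'y) tri_cat_scheme \<Rightarrow>
     ('a, 'b, 'k, 'z) lin_cat_scheme \<Rightarrow> ('o, 'm, 'p, 'n, 'a, 'b) bifunct \<Rightarrow> bool"
  where
  "duality C D A \<Phi> \<longleftrightarrow> biadditive_bifunctor C D A \<Phi> \<and>
     (\<forall>X Y Z f g h. \<forall>V\<in>Ob D. dist_triangle C X Y Z f g h \<longrightarrow>
        exact_seq A (bar \<Phi> g (Ident D V)) (bar \<Phi> f (Ident D V))) \<and>
     (\<forall>X Y Z f g h. \<forall>V\<in>Ob C. dist_triangle D X Y Z f g h \<longrightarrow>
        exact_seq A (bar \<Phi> (Ident C V) f) (bar \<Phi> (Ident C V) g)) \<and>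
     (\<exists>\<theta>. (\<forall>X\<in>Ob C. \<forall>Y\<in>Ob D. iso_arr A (\<theta> X Y) (bob \<Phi> X Y) (bob \<Phi> (sh_ob C X) (sh_ob D Y))) \<and>
          (\<forall>X X' Y Y' f g. \<guillemotleft>f : X \<rightarrow>\<^bsub>C\<^esub> X'\<guillemotright> \<and> \<guillemotleft>g : Y \<rightarrow>\<^bsub>D\<^esub> Y'\<guillemotright> \<longrightarrow>
             \<theta> X Y' \<cdot>\<^bsub>A\<^esub> bar \<Phi> f g = bar \<Phi> (sh_ar C f) (sh_ar D g) \<cdot>\<^bsub>A\<^esub> \<theta> X' Y))"

definition orth_right ::
    "('p, 'n, 'k, 'y) lin_cat_scheme \<Rightarrow> ('a, 'b, 'k, 'z) lin_cat_scheme \<Rightarrow>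
     ('o, 'm, 'p, 'n, 'a, 'b) bifunct \<Rightarrow> 'o set \<Rightarrow> 'p set"
  where
  "orth_right D A \<Phi> S = {Y \<in> Ob D. \<forall>X\<in>S. zero_object A (bob \<Phi> X Y)}"

definition orth_left ::
    "('o, 'm, 'k, 'x) lin_cat_scheme \<Rightarrow> ('a, 'b, 'k, 'z) lin_cat_scheme \<Rightarrow>
     ('o, 'm, 'p, 'n, 'a, 'b) bifunct \<Rightarrow> 'p set \<Rightarrow> 'o set"
  where
  "orth_left C A \<Phi> T = {X \<in> Ob C. \<forall>Y\<in>T. zero_object A (bob \<Phi> X Y)}"

definition strictly_left_orthogonal ::
    "('o, 'm, 'k, 'x) tri_cat_scheme \<Rightarrow> ('p, 'n, 'k, 'y) tri_cat_scheme \<Rightarrow>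
     ('a, 'b, 'k, 'z) lin_cat_scheme \<Rightarrow> ('o, 'm, 'p, 'n, 'a, 'b) bifunct \<Rightarrow>
     'o weight \<Rightarrow> 'p tstr \<Rightarrow> bool"
  where
  "strictly_left_orthogonal C D A \<Phi> w t \<longleftrightarrow>
     w_ge0 w = orth_left C A \<Phi> (t_lt0 D t) \<and>
     w_le0 w = orth_left C A \<Phi> (t_gt0 D t) \<and>
     t_lt0 D t = orth_right D A \<Phi> (w_ge0 w) \<and>
     t_gt0 D t = orth_right D A \<Phi> (w_le0 w)"

definition duality_adjoint ::
    "('o, 'm, 'k, 'x) lin_cat_scheme \<Rightarrow> ('q, 'l, 'k, 'v) lin_cat_scheme \<Rightarrow>
     ('a, 'b, 'k, 'z) lin_cat_scheme \<Rightarrow>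
     ('o, 'm, 'p, 'n, 'a, 'b) bifunct \<Rightarrow> ('r, 's, 'q, 'l, 'a, 'b) bifunct \<Rightarrow>
     ('o, 'm, 'r, 's) funct \<Rightarrow> ('q, 'l, 'p, 'n) funct \<Rightarrow> bool"
  where
  "duality_adjoint C D' A \<Phi> \<Phi>' F G \<longleftrightarrow>
     (\<exists>\<eta>. (\<forall>X\<in>Ob C. \<forall>Y\<in>Ob D'. iso_arr A (\<eta> X Y) (bob \<Phi>' (fob F X) Y) (bob \<Phi> X (fob G Y))) \<and>
          (\<forall>X X' Y Y' f g. \<guillemotleft>f : X \<rightarrow>\<^bsub>C\<^esub> X'\<guillemotright> \<and> \<guillemotleft>g : Y \<rightarrow>\<^bsub>D'\<^esub> Y'\<guillemotright> \<longrightarrow>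
             \<eta> X Y' \<cdot>\<^bsub>A\<^esub> bar \<Phi>' (far F f) g = bar \<Phi> f (far G g) \<cdot>\<^bsub>A\<^esub> \<eta> X' Y))"

end

theory Submission
  imports Defs
begin

text \<open>
  Vanishing of \<open>\<Phi>\<close> is invariant under isomorphisms and under shifting both arguments, so strict
  orthogonality passes from the pairs \<open>(w \<ge> 0, t < 0)\<close> and \<open>(w \<le> 0, t > 0)\<close> to the shifted pairs
  \<open>(w > 0, t \<le> 0)\<close> and \<open>(w < 0, t \<ge> 0)\<close>. Since \<open>\<Phi>'(F X, Y) \<cong> \<Phi>(X, G Y)\<close>, both sides of each
  equivalence say that \<open>\<Phi>(X, G Y) = 0\<close> for all \<open>X\<close> in the class for \<open>w\<close> and \<open>Y\<close> in the class
  for \<open>t'\<close>. The last claim follows because \<open>F\<close> commutes with the shifts.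
\<close>

section \<open>Isomorphism of objects and invariance of zero objects\<close>

lemma isomorphic_sym: "isomorphic C X Y \<Longrightarrow> isomorphic C Y X"
  unfolding isomorphic_def iso_arr_def by blast

lemma isomorphic_in_Ob: "isomorphic C X Y \<Longrightarrow> X \<in> Ob C \<and> Y \<in> Ob C"
  unfolding isomorphic_def iso_arr_def in_hom_def by blast

lemma iso_closedD: "\<lbrakk>iso_closed C S; X \<in> S; isomorphic C X Y\<rbrakk> \<Longrightarrow> Y \<in> S"
  unfolding iso_closed_def by blast

lemma karoubi_closed_imp_iso_closed: "karoubi_closed C S \<Longrightarrow> iso_closed C S"
  unfolding karoubi_closed_def iso_closed_def isomorphic_def iso_arr_def by blast

context linear_category
begin

lemma isomorphic_refl: "X \<in> Ob C \<Longrightarrow> isomorphic C X X"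
  unfolding isomorphic_def iso_arr_def
  using ident_in_hom comp_ident by blast

lemma isomorphic_trans:
  assumes "isomorphic C X Y" and "isomorphic C Y Z"
  shows "isomorphic C X Z"
proof -
  obtain f g where f: "\<guillemotleft>f : X \<rightarrow>\<^bsub>C\<^esub> Y\<guillemotright>" and g: "\<guillemotleft>g : Y \<rightarrow>\<^bsub>C\<^esub> X\<guillemotright>"
    and gf: "g \<cdot>\<^bsub>C\<^esub> f = Ident C X" and fg: "f \<cdot>\<^bsub>C\<^esub> g = Ident C Y"
    using assms(1) unfolding isomorphic_def iso_arr_def by blast
  obtain h k where h: "\<guillemotleft>h : Y \<rightarrow>\<^bsub>C\<^esub> Z\<guillemotright>" and k: "\<guillemotleft>k : Z \<rightarrow>\<^bsub>C\<^esub> Y\<guillemotright>"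
    and kh: "k \<cdot>\<^bsub>C\<^esub> h = Ident C Y" and hk: "h \<cdot>\<^bsub>C\<^esub> k = Ident C Z"
    using assms(2) unfolding isomorphic_def iso_arr_def by blast
  have hf: "\<guillemotleft>h \<cdot>\<^bsub>C\<^esub> f : X \<rightarrow>\<^bsub>C\<^esub> Z\<guillemotright>" and gk: "\<guillemotleft>g \<cdot>\<^bsub>C\<^esub> k : Z \<rightarrow>\<^bsub>C\<^esub> X\<guillemotright>"
    using comp_in_hom f g h k by blast+
  have "(g \<cdot>\<^bsub>C\<^esub> k) \<cdot>\<^bsub>C\<^esub> (h \<cdot>\<^bsub>C\<^esub> f) = g \<cdot>\<^bsub>C\<^esub> ((k \<cdot>\<^bsub>C\<^esub> h) \<cdot>\<^bsub>C\<^esub> f)"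
    using comp_assoc[OF hf k g] comp_assoc[OF f h k] by simp
  then have 1: "(g \<cdot>\<^bsub>C\<^esub> k) \<cdot>\<^bsub>C\<^esub> (h \<cdot>\<^bsub>C\<^esub> f) = Ident C X"
    using kh gf ident_comp[OF f] by simp
  have "(h \<cdot>\<^bsub>C\<^esub> f) \<cdot>\<^bsub>C\<^esub> (g \<cdot>\<^bsub>C\<^esub> k) = h \<cdot>\<^bsub>C\<^esub> ((f \<cdot>\<^bsub>C\<^esub> g) \<cdot>\<^bsub>C\<^esub> k)"
    using comp_assoc[OF gk f h] comp_assoc[OF k g f] by simp
  then have 2: "(h \<cdot>\<^bsub>C\<^esub> f) \<cdot>\<^bsub>C\<^esub> (g \<cdot>\<^bsub>C\<^esub> k) = Ident C Z"
    using fg hk ident_comp[OF k] by simp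
  show ?thesis
    unfolding isomorphic_def iso_arr_def using hf gk 1 2 by blast
qed

text \<open>Morphisms into or out of \<open>W\<close> are compared with those of \<open>Z\<close> by
  composing with \<open>f\<close> and \<open>g\<close>. Since \<open>f\<close> after
  \<open>g\<close> is the identity of \<open>W\<close>, any \<open>b\<close> into \<open>W\<close>
  equals \<open>f\<close> after (\<open>g\<close> after \<open>b\<close>), and the inner composite
  is the unique morphism into \<open>Z\<close>. The argument for morphisms out of \<open>W\<close>
  is dual.\<close>

lemma zero_object_isomorphic:
  assumes Z: "zero_object C Z" and iso: "isomorphic C Z W"
  shows "zero_object C W"
proof -
  obtain f g where f: "\<guillemotleft>f : Z \<rightarrow>\<^bsub>C\<^esub> W\<guillemotright>" and g: "\<guillemotleft>g : W \<rightarrow>\<^bsub>C\<^esub> Z\<guillemotright>"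
    and fg: "f \<cdot>\<^bsub>C\<^esub> g = Ident C W"
    using iso unfolding isomorphic_def iso_arr_def by blast
  have into: "\<exists>!a. \<guillemotleft>a : X \<rightarrow>\<^bsub>C\<^esub> W\<guillemotright>" if X: "X \<in> Ob C" for X
  proof -
    have ex1: "\<exists>!a. \<guillemotleft>a : X \<rightarrow>\<^bsub>C\<^esub> Z\<guillemotright>" using Z X by (simp add: zero_object_def)
    then obtain a where a: "\<guillemotleft>a : X \<rightarrow>\<^bsub>C\<^esub> Z\<guillemotright>" by (rule ex1E)
    have uniq: "b = a" if "\<guillemotleft>b : X \<rightarrow>\<^bsub>C\<^esub> Z\<guillemotright>" for b using ex1 that a by blast
    have "b = f \<cdot>\<^bsub>C\<^esub> a" if b: "\<guillemotleft>b : X \<rightarrow>\<^bsub>C\<^esub> W\<guillemotright>" for b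
      using comp_assoc[OF b g f] fg ident_comp[OF b] uniq[OF comp_in_hom[OF b g]] by simp
    with comp_in_hom[OF a f] show ?thesis by (rule ex1I)
  qed
  have out_of: "\<exists>!a. \<guillemotleft>a : W \<rightarrow>\<^bsub>C\<^esub> X\<guillemotright>" if X: "X \<in> Ob C" for X
  proof -
    have ex1: "\<exists>!a. \<guillemotleft>a : Z \<rightarrow>\<^bsub>C\<^esub> X\<guillemotright>" using Z X by (simp add: zero_object_def)
    then obtain a where a: "\<guillemotleft>a : Z \<rightarrow>\<^bsub>C\<^esub> X\<guillemotright>" by (rule ex1E)
    have uniq: "b = a" if "\<guillemotleft>b : Z \<rightarrow>\<^bsub>C\<^esub> X\<guillemotright>" for b using ex1 that a by blast
    have "b = a \<cdot>\<^bsub>C\<^esub> g" if b: "\<guillemotleft>b : W \<rightarrow>\<^bsub>C\<^esub> X\<guillemotright>" for b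
      using comp_assoc[OF g f b] fg comp_ident[OF b] uniq[OF comp_in_hom[OF f b]] by simp
    with comp_in_hom[OF g a] show ?thesis by (rule ex1I)
  qed
  show ?thesis
    unfolding zero_object_def
    by (intro conjI ballI into out_of conjunct2[OF isomorphic_in_Ob[OF iso]])
qed

lemma zero_object_cong: "isomorphic C Z W \<Longrightarrow> zero_object C Z \<longleftrightarrow> zero_object C W"
  using zero_object_isomorphic[of Z W] zero_object_isomorphic[of W Z] isomorphic_sym[of C Z W]
  by argo

end

section \<open>Additive functors and equivalences acting on isomorphism classes\<close>

lemma additive_functorD:
  assumes "additive_functor C D F"
  shows "X \<in> Ob C \<Longrightarrow> fob F X \<in> Ob D"
    and "\<guillemotleft>f : X \<rightarrow>\<^bsub>C\<^esub> Y\<guillemotright> \<Longrightarrow> \<guillemotleft>far F f : fob F X \<rightarrow>\<^bsub>D\<^esub> fob F Y\<guillemotright>"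
    and "X \<in> Ob C \<Longrightarrow> far F (Ident C X) = Ident D (fob F X)"
    and "\<lbrakk>\<guillemotleft>f : X \<rightarrow>\<^bsub>C\<^esub> Y\<guillemotright>; \<guillemotleft>g : Y \<rightarrow>\<^bsub>C\<^esub> Z\<guillemotright>\<rbrakk> \<Longrightarrow> far F (g \<cdot>\<^bsub>C\<^esub> f) = far F g \<cdot>\<^bsub>D\<^esub> far F f"
  using assms unfolding additive_functor_def by (elim conjE; metis)+

lemma additive_functor_isomorphic:
  assumes F: "additive_functor C D F" and "isomorphic C X Y"
  shows "isomorphic D (fob F X) (fob F Y)"
proof -
  obtain f g where f: "\<guillemotleft>f : X \<rightarrow>\<^bsub>C\<^esub> Y\<guillemotright>" and g: "\<guillemotleft>g : Y \<rightarrow>\<^bsub>C\<^esub> X\<guillemotright>"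
    and gf: "g \<cdot>\<^bsub>C\<^esub> f = Ident C X" and fg: "f \<cdot>\<^bsub>C\<^esub> g = Ident C Y"
    using assms(2) unfolding isomorphic_def iso_arr_def by blast
  have "X \<in> Ob C" "Y \<in> Ob C" using f unfolding in_hom_def by auto
  then have "far F g \<cdot>\<^bsub>D\<^esub> far F f = Ident D (fob F X)" "far F f \<cdot>\<^bsub>D\<^esub> far F g = Ident D (fob F Y)"
    using additive_functorD(3,4)[OF F] f g gf fg by metis+
  then show ?thesis
    using additive_functorD(2)[OF F f] additive_functorD(2)[OF F g]
    unfolding isomorphic_def iso_arr_def by blast
qed

context linear_category
begin

text \<open>Fullness lifts an isomorphism and its inverse to \<open>C\<close>; faithfulness then
  forces the two lifts to be mutually inverse, because their composites and the identities have the
  same image. Applied to the shift, this allows a shift to be cancelled up to isomorphism.\<close>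

lemma equivalence_reflects_isomorphic:
  assumes equiv: "equivalence C D F" and X: "X \<in> Ob C" and Y: "Y \<in> Ob C"
    and iso: "isomorphic D (fob F X) (fob F Y)"
  shows "isomorphic C X Y"
proof -
  have F: "additive_functor C D F" using equiv unfolding equivalence_def by (elim conjE)
  have bij: "bij_betw (far F) (carrier (Hom C V W)) (carrier (Hom D (fob F V) (fob F W)))"
    if "V \<in> Ob C" "W \<in> Ob C" for V W
    using equiv that unfolding equivalence_def by (elim conjE) simp
  have full: "\<exists>f. \<guillemotleft>f : V \<rightarrow>\<^bsub>C\<^esub> W\<guillemotright> \<and> far F f = u"
    if "V \<in> Ob C" "W \<in> Ob C" "\<guillemotleft>u : fob F V \<rightarrow>\<^bsub>D\<^esub> fob F W\<guillemotright>" for V W u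
  proof -
    have "u \<in> far F ` carrier (Hom C V W)"
      using bij_betw_imp_surj_on[OF bij[OF that(1,2)]] that(3) by (simp add: in_hom_def)
    then show ?thesis using that(1,2) by (auto simp: in_hom_def)
  qed
  have inverse: "g \<cdot>\<^bsub>C\<^esub> f = Ident C V"
    if f: "\<guillemotleft>f : V \<rightarrow>\<^bsub>C\<^esub> W\<guillemotright>" and g: "\<guillemotleft>g : W \<rightarrow>\<^bsub>C\<^esub> V\<guillemotright>"
      and eq: "far F g \<cdot>\<^bsub>D\<^esub> far F f = Ident D (fob F V)" for V W f g
  proof -
    have V: "V \<in> Ob C" using f unfolding in_hom_def by blast
    have "far F (g \<cdot>\<^bsub>C\<^esub> f) = far F (Ident C V)"
      using additive_functorD(3)[OF F V] additive_functorD(4)[OF F f g] eq by simp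
    moreover have "g \<cdot>\<^bsub>C\<^esub> f \<in> carrier (Hom C V V)" "Ident C V \<in> carrier (Hom C V V)"
      using comp_in_hom[OF f g] ident_in_hom[OF V] unfolding in_hom_def by auto
    \<comment> \<open>Faithfulness, as injectivity of \<open>far F\<close> on the endomorphisms of
      \<open>V\<close>.\<close>
    ultimately show ?thesis
      by (rule inj_onD[OF bij_betw_imp_inj_on[OF bij[OF V V]]])
  qed
  obtain u v where "\<guillemotleft>u : fob F X \<rightarrow>\<^bsub>D\<^esub> fob F Y\<guillemotright>" "\<guillemotleft>v : fob F Y \<rightarrow>\<^bsub>D\<^esub> fob F X\<guillemotright>"
    and uv: "v \<cdot>\<^bsub>D\<^esub> u = Ident D (fob F X)" "u \<cdot>\<^bsub>D\<^esub> v = Ident D (fob F Y)"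
    using iso unfolding isomorphic_def iso_arr_def by blast
  then obtain f g where f: "\<guillemotleft>f : X \<rightarrow>\<^bsub>C\<^esub> Y\<guillemotright>" "far F f = u" and g: "\<guillemotleft>g : Y \<rightarrow>\<^bsub>C\<^esub> X\<guillemotright>" "far F g = v"
    using full X Y by meson
  then show ?thesis
    using inverse[OF f(1) g(1)] inverse[OF g(1) f(1)] uv
    unfolding isomorphic_def iso_arr_def by blast
qed

end

section \<open>Shifting classes of objects, and images of shifted classes under functors\<close>

context triangulated_category
begin

lemma additive_shift: "additive_functor C C (shift C)"
  using shift_linear unfolding linear_functor_def by (elim conjE)

lemma sh_ob_in_Ob: "X \<in> Ob C \<Longrightarrow> sh_ob C X \<in> Ob C"
  by (rule additive_functorD(1)[OF additive_shift])

lemma sh_ob_isomorphic: "isomorphic C X Y \<Longrightarrow> isomorphic C (sh_ob C X) (sh_ob C Y)"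
  by (rule additive_functor_isomorphic[OF additive_shift])

lemma sh_ob_reflects_isomorphic:
  "\<lbrakk>X \<in> Ob C; Y \<in> Ob C; isomorphic C (sh_ob C X) (sh_ob C Y)\<rbrakk> \<Longrightarrow> isomorphic C X Y"
  by (rule equivalence_reflects_isomorphic[OF shift_equivalence])

text \<open>Essential surjectivity of the shift: \<open>Y\<close> plays the role of
  \<open>X[-1]\<close>, chosen for one object at a time.\<close>

lemma ex_desuspension:
  assumes "X \<in> Ob C" obtains Y where "Y \<in> Ob C" "isomorphic C (sh_ob C Y) X"
  using assms shift_equivalence unfolding equivalence_def by (elim conjE) blast

text \<open>The inclusion of \<open>S\<close> in \<open>S[-1][1]\<close> needs a desuspension of
  each object of \<open>S\<close>; the other inclusion is closure of \<open>S\<close> under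
  isomorphism.\<close>

lemma sub_up_sub_down:
  assumes S: "iso_closed C S" shows "sub_up C (sub_down C S) = S"
proof
  show "sub_up C (sub_down C S) \<subseteq> S"
    using iso_closedD[OF S] unfolding sub_up_def sub_down_def by blast
  show "S \<subseteq> sub_up C (sub_down C S)"
  proof
    fix X assume X: "X \<in> S"
    then have "X \<in> Ob C" using S unfolding iso_closed_def by blast
    then obtain Y where Y: "Y \<in> Ob C" "isomorphic C (sh_ob C Y) X" by (rule ex_desuspension)
    have "sh_ob C Y \<in> S" using iso_closedD[OF S X isomorphic_sym] Y(2) by blast
    then show "X \<in> sub_up C (sub_down C S)"
      using Y \<open>X \<in> Ob C\<close> unfolding sub_up_def sub_down_def by blast
  qed
qed

lemma sub_down_sub_up:
  assumes S: "iso_closed C S" shows "sub_down C (sub_up C S) = S"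
proof
  show "sub_down C (sub_up C S) \<subseteq> S"
    \<comment> \<open>Here \<open>X[1]\<close> is isomorphic to \<open>Y[1]\<close> for some
      \<open>Y\<close> in \<open>S\<close>; cancelling the shift gives an isomorphism of
      \<open>Y\<close> with \<open>X\<close>.\<close>
    using sh_ob_reflects_isomorphic iso_closedD[OF S] S
    unfolding sub_up_def sub_down_def iso_closed_def by blast
  show "S \<subseteq> sub_down C (sub_up C S)"
    using isomorphic_refl sh_ob_in_Ob S
    unfolding sub_up_def sub_down_def iso_closed_def by blast
qed

lemma iso_closed_sub_up: "iso_closed C (sub_up C S)"
proof -
  have "Y \<in> sub_up C S" if X: "X \<in> sub_up C S" and iso: "isomorphic C X Y" for X Y
  proof -
    obtain V where V: "V \<in> S" "isomorphic C (sh_ob C V) X" using X unfolding sub_up_def by blast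
    have "isomorphic C (sh_ob C V) Y" by (rule isomorphic_trans[OF V(2) iso])
    then show ?thesis
      using V(1) isomorphic_in_Ob[OF iso] unfolding sub_up_def by blast
  qed
  moreover have "sub_up C S \<subseteq> Ob C" unfolding sub_up_def by blast
  ultimately show ?thesis unfolding iso_closed_def by blast
qed

end

text \<open>\<open>F(X[1])\<close> and \<open>F(X)[1]\<close> are isomorphic, and classes closed
  under isomorphism cannot tell them apart. This links conditions on \<open>w_gt0\<close> to
  conditions on \<open>w_ge0\<close>.\<close>

lemma triangulated_functor_image_sub_down:
  assumes "triangulated_category K C" and "triangulated_category K D"
    and F: "triangulated_functor C D F" and S: "iso_closed C S" and T: "iso_closed D T"
  shows "fob F ` sub_down C S \<subseteq> sub_down D T \<longleftrightarrow> fob F ` S \<subseteq> T"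
proof -
  interpret C: triangulated_category K C by fact
  interpret D: triangulated_category K D by fact
  have add: "additive_functor C D F"
    and comm: "\<And>X. X \<in> Ob C \<Longrightarrow> isomorphic D (fob F (sh_ob C X)) (sh_ob D (fob F X))"
    using F unfolding triangulated_functor_def isomorphic_def by blast+
  have ob: "X \<in> Ob C \<Longrightarrow> fob F X \<in> Ob D" for X
    by (rule additive_functorD(1)[OF add])
  show ?thesis
  proof
    assume *: "fob F ` sub_down C S \<subseteq> sub_down D T"
    show "fob F ` S \<subseteq> T"
    proof (rule image_subsetI)
      fix X assume "X \<in> S"
      \<comment> \<open>With \<open>Y\<close> as a desuspension of \<open>X\<close>, membership in
        \<open>T\<close> is passed from \<open>F(Y)[1]\<close> to \<open>F(Y[1])\<close> and then to
        \<open>F(X)\<close>.\<close>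
      then obtain Y where Y: "Y \<in> sub_down C S" "isomorphic C (sh_ob C Y) X"
        using C.sub_up_sub_down[OF S] unfolding sub_up_def by blast
      have "Y \<in> Ob C" using Y(1) unfolding sub_down_def by blast
      have "sh_ob D (fob F Y) \<in> T" using * Y(1) unfolding sub_down_def by blast
      then have "fob F (sh_ob C Y) \<in> T"
        using iso_closedD[OF T] isomorphic_sym[OF comm[OF \<open>Y \<in> Ob C\<close>]] by blast
      then show "fob F X \<in> T"
        using iso_closedD[OF T] additive_functor_isomorphic[OF add Y(2)] by blast
    qed
  next
    assume "fob F ` S \<subseteq> T"
    then show "fob F ` sub_down C S \<subseteq> sub_down D T"
      using comm iso_closedD[OF T] ob unfolding sub_down_def by blast
  qed
qed

lemma triangulated_functor_image_sub_up:
  assumes C: "triangulated_category K C" and D: "triangulated_category K D"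
    and F: "triangulated_functor C D F" and S: "iso_closed C S" and T: "iso_closed D T"
  shows "fob F ` sub_up C S \<subseteq> sub_up D T \<longleftrightarrow> fob F ` S \<subseteq> T"
  \<comment> \<open>Shifting down is applied to \<open>S[1]\<close> and \<open>T[1]\<close>; since
    \<open>S[1][-1] = S\<close> and \<open>T[1][-1] = T\<close>, the equivalence is the desired one
    read from right to left.\<close>
  using triangulated_functor_image_sub_down[OF C D F
      triangulated_category.iso_closed_sub_up[OF C, of S]
      triangulated_category.iso_closed_sub_up[OF D, of T]]
  by (simp add: triangulated_category.sub_down_sub_up[OF C S]
      triangulated_category.sub_down_sub_up[OF D T])

section \<open>Orthogonals of shift-invariant relations\<close>

text \<open>
  Abstracting vanishing of a duality to a relation lets left and right orthogonals be treated
  alike: the right orthogonals are those of the converse relation.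
\<close>

definition perp :: "('o, 'm, 'k, 'x) lin_cat_scheme \<Rightarrow> ('o \<Rightarrow> 'p \<Rightarrow> bool) \<Rightarrow> 'p set \<Rightarrow> 'o set" where
  "perp C R T = {X \<in> Ob C. \<forall>Y\<in>T. R X Y}"

text \<open>The assumptions are the two invariances of vanishing on which the shifting argument
  rests. They are symmetric in \<open>C\<close> and \<open>D\<close>, so every result below also
  holds for the converse relation.\<close>

locale shift_invariant_relation =
  C: triangulated_category K C + D: triangulated_category K D
  for K :: "'k ring" and C :: "('o, 'm, 'k, 'x) tri_cat_scheme"
    and D :: "('p, 'n, 'k, 'y) tri_cat_scheme" +
  fixes R :: "'o \<Rightarrow> 'p \<Rightarrow> bool"
  assumes isomorphic_cong:
      "\<lbrakk>isomorphic C X X'; isomorphic D Y Y'\<rbrakk> \<Longrightarrow> R X Y \<longleftrightarrow> R X' Y'"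
    and shift_cong: "\<lbrakk>X \<in> Ob C; Y \<in> Ob D\<rbrakk> \<Longrightarrow> R (sh_ob C X) (sh_ob D Y) \<longleftrightarrow> R X Y"
begin

lemma iso_closed_perp:
  assumes T: "T \<subseteq> Ob D" shows "iso_closed C (perp C R T)"
proof -
  have "X' \<in> perp C R T" if X: "X \<in> perp C R T" and iso: "isomorphic C X X'" for X X'
  proof -
    have "R X' Y" if Y: "Y \<in> T" for Y
    proof -
      have "Y \<in> Ob D" using T Y by blast
      then show ?thesis
        using isomorphic_cong[OF iso D.isomorphic_refl] X Y unfolding perp_def by blast
    qed
    then show ?thesis using isomorphic_in_Ob[OF iso] unfolding perp_def by blast
  qed
  moreover have "perp C R T \<subseteq> Ob C" unfolding perp_def by blast
  ultimately show ?thesis unfolding iso_closed_def by blast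
qed

text \<open>\<open>X[1]\<close> is related to all of \<open>T[1]\<close> exactly when
  \<open>X\<close> is related to all of \<open>T\<close>. Objects of \<open>sub_up D T\<close> are
  only isomorphic to shifts of objects of \<open>T\<close>, so invariance under isomorphism enters
  as well.\<close>

lemma sub_down_perp_sub_up:
  assumes T: "T \<subseteq> Ob D"
  shows "sub_down C (perp C R (sub_up D T)) = perp C R T"
proof -
  have "(\<forall>Y\<in>sub_up D T. R (sh_ob C X) Y) \<longleftrightarrow> (\<forall>Y\<in>T. R X Y)" if X: "X \<in> Ob C" for X
  proof
    assume *: "\<forall>Y\<in>sub_up D T. R (sh_ob C X) Y"
    show "\<forall>Y\<in>T. R X Y"
    proof
      fix Y assume Y: "Y \<in> T"
      then have "sh_ob D Y \<in> sub_up D T"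
        using T D.sh_ob_in_Ob D.isomorphic_refl unfolding sub_up_def by blast
      then show "R X Y" using * shift_cong[OF X] T Y by blast
    qed
  next
    assume *: "\<forall>Y\<in>T. R X Y"
    show "\<forall>Y\<in>sub_up D T. R (sh_ob C X) Y"
    proof
      fix Y assume "Y \<in> sub_up D T"
      then obtain V where V: "V \<in> T" "isomorphic D (sh_ob D V) Y" unfolding sub_up_def by blast
      have "R (sh_ob C X) (sh_ob D V)" using * shift_cong[OF X] T V(1) by blast
      then show "R (sh_ob C X) Y"
        using isomorphic_cong[OF C.isomorphic_refl[OF C.sh_ob_in_Ob[OF X]] V(2)] by blast
    qed
  qed
  then show ?thesis using C.sh_ob_in_Ob unfolding sub_down_def perp_def by blast
qed

lemma sub_up_perp_sub_down:
  assumes T: "iso_closed D T"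
  shows "sub_up C (perp C R (sub_down D T)) = perp C R T"
proof -
  have T_Ob: "T \<subseteq> Ob D" using T unfolding iso_closed_def by blast
  have "sub_down D T \<subseteq> Ob D" unfolding sub_down_def by blast
  \<comment> \<open>The preceding lemma for \<open>T[-1]\<close>, where \<open>T[-1][1] = T\<close>
    as \<open>T\<close> is closed under isomorphism. Shifting both sides up then gives the
    claim.\<close>
  then have "sub_down C (perp C R T) = perp C R (sub_down D T)"
    using sub_down_perp_sub_up[of "sub_down D T"] D.sub_up_sub_down[OF T] by simp
  then show ?thesis using C.sub_up_sub_down[OF iso_closed_perp[OF T_Ob]] by simp
qed

end

lemma shift_invariant_relation_converse:
  "shift_invariant_relation K C D R \<Longrightarrow> shift_invariant_relation K D C (\<lambda>Y X. R X Y)"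
  unfolding shift_invariant_relation_def shift_invariant_relation_axioms_def by blast

section \<open>Vanishing of a duality as a shift-invariant relation\<close>

text \<open>By contravariance in the first argument, the isomorphism is
  \<open>bar \<Phi> f' g\<close>, with inverse \<open>bar \<Phi> f g'\<close>.\<close>

lemma biadditive_bifunctor_isomorphic:
  assumes \<Phi>: "biadditive_bifunctor C D A \<Phi>"
    and iso: "isomorphic C X X'" "isomorphic D Y Y'"
  shows "isomorphic A (bob \<Phi> X Y) (bob \<Phi> X' Y')"
proof -
  obtain f f' where f: "\<guillemotleft>f : X \<rightarrow>\<^bsub>C\<^esub> X'\<guillemotright>" "\<guillemotleft>f' : X' \<rightarrow>\<^bsub>C\<^esub> X\<guillemotright>"
    and ff': "f' \<cdot>\<^bsub>C\<^esub> f = Ident C X" "f \<cdot>\<^bsub>C\<^esub> f' = Ident C X'"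
    using iso(1) unfolding isomorphic_def iso_arr_def by blast
  obtain g g' where g: "\<guillemotleft>g : Y \<rightarrow>\<^bsub>D\<^esub> Y'\<guillemotright>" "\<guillemotleft>g' : Y' \<rightarrow>\<^bsub>D\<^esub> Y\<guillemotright>"
    and gg': "g' \<cdot>\<^bsub>D\<^esub> g = Ident D Y" "g \<cdot>\<^bsub>D\<^esub> g' = Ident D Y'"
    using iso(2) unfolding isomorphic_def iso_arr_def by blast
  have ob: "X \<in> Ob C" "X' \<in> Ob C" "Y \<in> Ob D" "Y' \<in> Ob D"
    using f g unfolding in_hom_def by auto
  have hom: "\<guillemotleft>bar \<Phi> a b : bob \<Phi> V' W \<rightarrow>\<^bsub>A\<^esub> bob \<Phi> V W'\<guillemotright>"
    if "\<guillemotleft>a : V \<rightarrow>\<^bsub>C\<^esub> V'\<guillemotright>" "\<guillemotleft>b : W \<rightarrow>\<^bsub>D\<^esub> W'\<guillemotright>" for a b V V' W W'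
    using \<Phi> that unfolding biadditive_bifunctor_def by (elim conjE) simp
  have comp: "bar \<Phi> a b' \<cdot>\<^bsub>A\<^esub> bar \<Phi> a' b = Ident A (bob \<Phi> V W)"
    if "\<guillemotleft>a : V \<rightarrow>\<^bsub>C\<^esub> V'\<guillemotright>" "\<guillemotleft>a' : V' \<rightarrow>\<^bsub>C\<^esub> V\<guillemotright>" "a' \<cdot>\<^bsub>C\<^esub> a = Ident C V"
      "\<guillemotleft>b : W \<rightarrow>\<^bsub>D\<^esub> W'\<guillemotright>" "\<guillemotleft>b' : W' \<rightarrow>\<^bsub>D\<^esub> W\<guillemotright>" "b' \<cdot>\<^bsub>D\<^esub> b = Ident D W"
      "V \<in> Ob C" "W \<in> Ob D" for a a' b b' V V' W W'
  proof -
    \<comment> \<open>The chain of \<open>conjunct2\<close> and \<open>conjunct1\<close> selects the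
      clause of \<open>biadditive_bifunctor\<close> on composition.\<close>
    have "bar \<Phi> (a' \<cdot>\<^bsub>C\<^esub> a) (b' \<cdot>\<^bsub>D\<^esub> b) = bar \<Phi> a b' \<cdot>\<^bsub>A\<^esub> bar \<Phi> a' b"
      using \<Phi>[unfolded biadditive_bifunctor_def, THEN conjunct2, THEN conjunct2, THEN conjunct2,
          THEN conjunct1] that(1,2,4,5) by blast
    moreover have "bar \<Phi> (Ident C V) (Ident D W) = Ident A (bob \<Phi> V W)"
      using \<Phi> that(7,8) unfolding biadditive_bifunctor_def by (elim conjE) simp
    ultimately show ?thesis using that(3,6) by simp
  qed
  show ?thesis
    unfolding isomorphic_def iso_arr_def
    using hom[OF f(2) g(1)] hom[OF f(1) g(2)]
      comp[OF f(1,2) ff'(1) g gg'(1) ob(1,3)]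
      comp[OF f(2,1) ff'(2) g(2,1) gg'(2) ob(2,4)] by blast
qed

abbreviation vanishes ::
  "('a, 'b, 'k, 'z) lin_cat_scheme \<Rightarrow> ('o, 'm, 'p, 'n, 'a, 'b) bifunct \<Rightarrow> 'o \<Rightarrow> 'p \<Rightarrow> bool" where
  "vanishes A \<Phi> X Y \<equiv> zero_object A (bob \<Phi> X Y)"

lemma duality_shift_invariant:
  assumes C: "triangulated_category K C" and D: "triangulated_category K D"
    and A: "linear_category K A" and \<Phi>: "duality C D A \<Phi>"
  shows "shift_invariant_relation K C D (vanishes A \<Phi>)"
proof -
  have bif: "biadditive_bifunctor C D A \<Phi>" using \<Phi> unfolding duality_def by (elim conjE)
  have "vanishes A \<Phi> X Y \<longleftrightarrow> vanishes A \<Phi> X' Y'"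
    if "isomorphic C X X'" "isomorphic D Y Y'" for X X' Y Y'
    by (rule linear_category.zero_object_cong[OF A biadditive_bifunctor_isomorphic[OF bif that]])
  moreover have "vanishes A \<Phi> (sh_ob C X) (sh_ob D Y) \<longleftrightarrow> vanishes A \<Phi> X Y"
    if "X \<in> Ob C" "Y \<in> Ob D" for X Y
  proof -
    have "\<exists>\<theta>. \<forall>X\<in>Ob C. \<forall>Y\<in>Ob D.
        iso_arr A (\<theta> X Y) (bob \<Phi> X Y) (bob \<Phi> (sh_ob C X) (sh_ob D Y))"
      using \<Phi> unfolding duality_def by (elim conjE exE) (rule exI)
    then have "isomorphic A (bob \<Phi> X Y) (bob \<Phi> (sh_ob C X) (sh_ob D Y))"
      using that unfolding isomorphic_def by blast
    then show ?thesis using linear_category.zero_object_cong[OF A] by simp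
  qed
  ultimately show ?thesis
    by (intro shift_invariant_relation.intro shift_invariant_relation_axioms.intro C D)
qed

section \<open>Orthogonality of the shifted classes, and adjoint functors\<close>

lemma orth_left_perp: "orth_left C A \<Phi> T = perp C (vanishes A \<Phi>) T"
  unfolding orth_left_def perp_def by simp

lemma orth_right_perp: "orth_right D A \<Phi> S = perp D (\<lambda>Y X. vanishes A \<Phi> X Y) S"
  unfolding orth_right_def perp_def by simp

lemma weight_structure_iso_closed:
  assumes "weight_structure C w"
  shows "iso_closed C (w_le0 w)" and "iso_closed C (w_ge0 w)"
  using assms karoubi_closed_imp_iso_closed unfolding weight_structure_def by blast+

lemma t_structure_iso_closed:
  assumes "t_structure D t"
  shows "iso_closed D (t_le0 t)" and "iso_closed D (t_ge0 t)"
  using assms unfolding t_structure_def by blast+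

text \<open>The equations between \<open>w_ge0\<close> and \<open>t_lt0\<close> are shifted by
  \<open>[-1]\<close>, those between \<open>w_le0\<close> and \<open>t_gt0\<close> by
  \<open>[1]\<close>. The left orthogonals use the vanishing relation, the right ones its
  converse.\<close>

lemma strictly_left_orthogonal_shifted:
  assumes C: "triangulated_category K C" and D: "triangulated_category K D"
    and A: "linear_category K A" and w: "weight_structure C w" and t: "t_structure D t"
    and \<Phi>: "duality C D A \<Phi>" and orth: "strictly_left_orthogonal C D A \<Phi> w t"
  shows "w_gt0 C w = orth_left C A \<Phi> (t_le0 t)"
    and "w_lt0 C w = orth_left C A \<Phi> (t_ge0 t)"
    and "t_le0 t = orth_right D A \<Phi> (w_gt0 C w)"
    and "t_ge0 t = orth_right D A \<Phi> (w_lt0 C w)"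
proof -
  interpret L: shift_invariant_relation K C D "vanishes A \<Phi>"
    by (rule duality_shift_invariant[OF C D A \<Phi>])
  interpret R: shift_invariant_relation K D C "\<lambda>Y X. vanishes A \<Phi> X Y"
    by (rule shift_invariant_relation_converse) (rule L.shift_invariant_relation_axioms)
  note closed = weight_structure_iso_closed[OF w] t_structure_iso_closed[OF t]
  have eqs: "w_ge0 w = perp C (vanishes A \<Phi>) (t_lt0 D t)"
      "w_le0 w = perp C (vanishes A \<Phi>) (t_gt0 D t)"
      "t_lt0 D t = perp D (\<lambda>Y X. vanishes A \<Phi> X Y) (w_ge0 w)"
      "t_gt0 D t = perp D (\<lambda>Y X. vanishes A \<Phi> X Y) (w_le0 w)"
    using orth unfolding strictly_left_orthogonal_def orth_left_perp orth_right_perp by blast+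
  have ob: "t_le0 t \<subseteq> Ob D" "w_gt0 C w \<subseteq> Ob C"
    using closed unfolding iso_closed_def sub_down_def by blast+
  show "w_gt0 C w = orth_left C A \<Phi> (t_le0 t)"
    unfolding orth_left_perp eqs(1) by (rule L.sub_down_perp_sub_up[OF ob(1)])
  show "w_lt0 C w = orth_left C A \<Phi> (t_ge0 t)"
    unfolding orth_left_perp eqs(2) by (rule L.sub_up_perp_sub_down[OF closed(4)])
  \<comment> \<open>The shifting lemma for the converse relation expects the orthogonal of a class
    shifted up, so \<open>w_ge0 w\<close> is first rewritten as \<open>w_gt0\<close> shifted
    up.\<close>
  have "t_le0 t = sub_down D (t_lt0 D t)"
    by (simp add: L.D.sub_down_sub_up closed)
  also have "\<dots> = sub_down D (perp D (\<lambda>Y X. vanishes A \<Phi> X Y) (sub_up C (w_gt0 C w)))"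
    using eqs(3) L.C.sub_up_sub_down[OF closed(2)] by simp
  also have "\<dots> = orth_right D A \<Phi> (w_gt0 C w)"
    unfolding orth_right_perp by (rule R.sub_down_perp_sub_up[OF ob(2)])
  finally show "t_le0 t = orth_right D A \<Phi> (w_gt0 C w)" .
  \<comment> \<open>The mirror image: \<open>w_le0 w\<close> is rewritten as \<open>w_lt0\<close>
    shifted down.\<close>
  have "t_ge0 t = sub_up D (t_gt0 D t)"
    by (simp add: L.D.sub_up_sub_down closed)
  also have "\<dots> = sub_up D (perp D (\<lambda>Y X. vanishes A \<Phi> X Y) (sub_down C (w_lt0 C w)))"
    using eqs(4) L.C.sub_down_sub_up[OF closed(1)] by simp
  also have "\<dots> = orth_right D A \<Phi> (w_lt0 C w)"
    unfolding orth_right_perp by (rule R.sub_up_perp_sub_down[OF L.C.iso_closed_sub_up])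
  finally show "t_ge0 t = orth_right D A \<Phi> (w_lt0 C w)" .
qed

text \<open>The adjunction isomorphism turns \<open>\<Phi>'(F X, Y) = 0\<close> into
  \<open>\<Phi>(X, G Y) = 0\<close>, so the two inclusions differ only in the order of the
  quantifiers over \<open>S\<close> and \<open>T\<close>.\<close>

lemma duality_adjoint_image_orth:
  assumes A: "linear_category K A"
    and F: "additive_functor C C' F" and G: "additive_functor D' D G"
    and adj: "duality_adjoint C D' A \<Phi> \<Phi>' F G" and S: "S \<subseteq> Ob C" and T: "T \<subseteq> Ob D'"
  shows "fob F ` S \<subseteq> orth_left C' A \<Phi>' T \<longleftrightarrow> fob G ` T \<subseteq> orth_right D A \<Phi> S"
proof -
  have "isomorphic A (bob \<Phi>' (fob F X) Y) (bob \<Phi> X (fob G Y))" if "X \<in> Ob C" "Y \<in> Ob D'" for X Y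
    using adj that unfolding duality_adjoint_def isomorphic_def by blast
  then have "vanishes A \<Phi>' (fob F X) Y \<longleftrightarrow> vanishes A \<Phi> X (fob G Y)"
    if "X \<in> S" "Y \<in> T" for X Y
    using that S T by (intro linear_category.zero_object_cong[OF A]) (simp add: subset_iff)
  then have "(\<forall>X\<in>S. \<forall>Y\<in>T. vanishes A \<Phi>' (fob F X) Y) \<longleftrightarrow>
      (\<forall>Y\<in>T. \<forall>X\<in>S. vanishes A \<Phi> X (fob G Y))"
    by blast
  moreover have "fob F X \<in> Ob C'" if "X \<in> S" for X
    using additive_functorD(1)[OF F] S that by blast
  moreover have "fob G Y \<in> Ob D" if "Y \<in> T" for Y
    using additive_functorD(1)[OF G] T that by blast
  ultimately show ?thesis
    by (simp add: image_subset_iff orth_left_def orth_right_def)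
qed

theorem theorem5p1:
  fixes K :: "'k ring"
    and C :: "('c, 'mc, 'k) tri_cat" and C' :: "('c', 'mc', 'k) tri_cat"
    and D :: "('d, 'md, 'k) tri_cat" and D' :: "('d', 'md', 'k) tri_cat"
    and A :: "('a, 'ma, 'k) lin_cat"
    and w :: "'c weight" and w' :: "'c' weight" and t :: "'d tstr" and t' :: "'d' tstr"
    and \<Phi> :: "('c, 'mc, 'd, 'md, 'a, 'ma) bifunct"
    and \<Phi>' :: "('c', 'mc', 'd', 'md', 'a, 'ma) bifunct"
    and F :: "('c, 'mc, 'c', 'mc') funct" and G :: "('d', 'md', 'd, 'md) funct"
  assumes "triangulated_category K C" and "triangulated_category K C'"
    and "triangulated_category K D" and "triangulated_category K D'"
    and "abelian_category K A"
    and "weight_structure C w" and "weight_structure C' w'"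
    and "t_structure D t" and "t_structure D' t'"
    and "duality C D A \<Phi>" and "duality C' D' A \<Phi>'"
    and "strictly_left_orthogonal C D A \<Phi> w t"
    and "strictly_left_orthogonal C' D' A \<Phi>' w' t'"
    and "triangulated_functor C C' F" and "triangulated_functor D' D G"
    and "duality_adjoint C D' A \<Phi> \<Phi>' F G"
  shows "(fob F ` w_gt0 C w \<subseteq> w_gt0 C' w' \<longleftrightarrow> fob G ` t_le0 t' \<subseteq> t_le0 t) \<and>
         (fob F ` w_lt0 C w \<subseteq> w_lt0 C' w' \<longleftrightarrow> fob G ` t_ge0 t' \<subseteq> t_ge0 t) \<and>
         (weight_exact w w' F \<longleftrightarrow> t_exact t' t G)"
proof (intro conjI)
  have A: "linear_category K A"
    using assms(5) unfolding abelian_category_def additive_category_def by blast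
  note tri = \<open>triangulated_category K C\<close> \<open>triangulated_category K C'\<close>
    \<open>triangulated_category K D\<close> \<open>triangulated_category K D'\<close>
  note w = weight_structure_iso_closed[OF \<open>weight_structure C w\<close>]
  note w' = weight_structure_iso_closed[OF \<open>weight_structure C' w'\<close>]
  note t' = t_structure_iso_closed[OF \<open>t_structure D' t'\<close>]
  note orth = strictly_left_orthogonal_shifted[OF tri(1,3) A assms(6,8,10,12)]
  note orth' = strictly_left_orthogonal_shifted[OF tri(2,4) A assms(7,9,11,13)]
  have ob: "w_gt0 C w \<subseteq> Ob C" "w_lt0 C w \<subseteq> Ob C" "t_le0 t' \<subseteq> Ob D'" "t_ge0 t' \<subseteq> Ob D'"
    using t' unfolding sub_up_def sub_down_def iso_closed_def by blast+
  note adj = duality_adjoint_image_orth[OF A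
      assms(14,15)[unfolded triangulated_functor_def, THEN conjunct1] assms(16)]
  show gt: "fob F ` w_gt0 C w \<subseteq> w_gt0 C' w' \<longleftrightarrow> fob G ` t_le0 t' \<subseteq> t_le0 t"
    \<comment> \<open>For this pair of classes, the left orthogonal under \<open>\<Phi>'\<close> is
      read off from \<open>w'\<close> and \<open>t'\<close>, the right orthogonal under
      \<open>\<Phi>\<close> from \<open>w\<close> and \<open>t\<close>.\<close>
    using adj[OF ob(1,3)] unfolding orth(3)[symmetric] orth'(1)[symmetric] .
  show lt: "fob F ` w_lt0 C w \<subseteq> w_lt0 C' w' \<longleftrightarrow> fob G ` t_ge0 t' \<subseteq> t_ge0 t"
    using adj[OF ob(2,4)] unfolding orth(4)[symmetric] orth'(2)[symmetric] .
  show "weight_exact w w' F \<longleftrightarrow> t_exact t' t G"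
    \<comment> \<open>The conditions on \<open>G\<close> become conditions on \<open>w_gt0\<close>
      and \<open>w_lt0\<close>, and then on \<open>w_ge0\<close> and \<open>w_le0\<close>. As
      \<open>t_le0\<close> corresponds to \<open>w_ge0\<close> and \<open>t_ge0\<close> to
      \<open>w_le0\<close>, the conjuncts end up in the opposite order.\<close>
    unfolding weight_exact_def t_exact_def gt[symmetric] lt[symmetric]
      triangulated_functor_image_sub_down[OF tri(1,2) assms(14) w(2) w'(2)]
      triangulated_functor_image_sub_up[OF tri(1,2) assms(14) w(1) w'(1)]
    by (rule conj_commute)
qed

end
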